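(* Let $X$ be a finite quandle and $R$ an associative ring (not necessarily with unity). Then for each $x_0\in X$ and each two-sided ideal $I$ of $R[X]$, the set $X_{I,x_0}=\{x\in X \mid x-x_0\in I\}$ is a subquandle of $X$. Further, there is a subset $\{x_1,\dots,x_m\}$ of $X$ such that $X$ is the disjoint union $X=X_{I,x_1}\sqcup\cdots\sqcup X_{I,x_m}$.
   Context: A quandle is a non-empty set $X$ with a binary operation $(x,y)\mapsto x.y$ such that: (R1) for all $x,y\in X$ there is a unique $z\in X$ with $x=z.y$; (R2) $(x.y).z=(x.z).(y.z)$ for all $x,y,z\in X$; (Q1) $x.x=x$ for all $x\in X$. A subquandle is a subset that is a quandle under the restricted operation. The quandle ring $R[X]$ is the set of formal finite $R$-linear combinations $\sum_i\alpha_i x_i$ ($\alpha_i\in R$, $x_i\in X$) with the usual addition and the (generally non-associative) multiplication $(\sum_i\alpha_i x_i).(\sum_j\beta_j x_j)=\sum_{i,j}\alpha_i\beta_j(x_i.x_j)$; elements of $X$ are regarded as elements of $R[X]$. A two-sided ideal of $R[X]$ is an additive subgroup closed under left and right multiplication by arbitrary elements of $R[X]$.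
   Formalization: If R has no unity, x is not an element of R[X], so x − x_0 is undefined for x ≠ x_0; the formal statement reads x as ex when R has a unity e, and otherwise counts x − x_0 as lying in I only when x = x_0. *)

theory Defs
  imports "HOL-Library.Poly_Mapping" "HOL-Library.Disjoint_Sets"
begin


definition quandle :: "'a set \<Rightarrow> ('a \<Rightarrow> 'a \<Rightarrow> 'a) \<Rightarrow> bool" where
  "quandle X f \<longleftrightarrow>
     X \<noteq> {} \<and>
     (\<forall>x\<in>X. \<forall>y\<in>X. f x y \<in> X) \<and>
     (\<forall>x\<in>X. \<forall>y\<in>X. \<exists>!z. z \<in> X \<and> x = f z y) \<and>
     (\<forall>x\<in>X. \<forall>y\<in>X. \<forall>z\<in>X. f (f x y) z = f (f x z) (f y z)) \<and>
     (\<forall>x\<in>X. f x x = x)"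

definition subquandle :: "'a set \<Rightarrow> 'a set \<Rightarrow> ('a \<Rightarrow> 'a \<Rightarrow> 'a) \<Rightarrow> bool" where
  "subquandle Y X f \<longleftrightarrow> Y \<subseteq> X \<and> quandle Y f"

text \<open>Coefficients range over the class \<open>ring\<close>, whose members are associative but need not
  have a unity. The product of \<open>'a \<Rightarrow>\<^sub>0 'r\<close> provided by the library is convolution with
  respect to addition on \<open>'a\<close>, so it is not used here.\<close>

definition quandle_ring :: "'a set \<Rightarrow> ('a \<Rightarrow>\<^sub>0 'r::ring) set" where
  "quandle_ring X = {p. Poly_Mapping.keys p \<subseteq> X}"

definition qmult ::
    "('a \<Rightarrow> 'a \<Rightarrow> 'a) \<Rightarrow> ('a \<Rightarrow>\<^sub>0 'r::ring) \<Rightarrow> ('a \<Rightarrow>\<^sub>0 'r) \<Rightarrow> ('a \<Rightarrow>\<^sub>0 'r)" where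
  "qmult f p q =
     (\<Sum>x\<in>Poly_Mapping.keys p. \<Sum>y\<in>Poly_Mapping.keys q.
        Poly_Mapping.single (f x y) (Poly_Mapping.lookup p x * Poly_Mapping.lookup q y))"

definition two_sided_ideal ::
    "'a set \<Rightarrow> ('a \<Rightarrow> 'a \<Rightarrow> 'a) \<Rightarrow> ('a \<Rightarrow>\<^sub>0 'r::ring) set \<Rightarrow> bool" where
  "two_sided_ideal X f I \<longleftrightarrow>
     I \<subseteq> quandle_ring X \<and>
     0 \<in> I \<and>
     (\<forall>p\<in>I. \<forall>q\<in>I. p + q \<in> I) \<and>
     (\<forall>p\<in>I. - p \<in> I) \<and>
     (\<forall>p\<in>I. \<forall>a\<in>quandle_ring X. qmult f a p \<in> I \<and> qmult f p a \<in> I)"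

definition is_unity :: "'r::ring \<Rightarrow> bool" where
  "is_unity e \<longleftrightarrow> (\<forall>r. e * r = r \<and> r * e = r)"

text \<open>\<open>p\<close> is the element \<open>x - y\<close> of the quandle ring. If the coefficient ring has a unity \<open>e\<close>,
  then \<open>x\<close> is regarded as \<open>e x\<close>. If it has none, a formal difference of two distinct elements
  has coefficients outside the ring, so it is not an element of the quandle ring; the difference
  \<open>x - x\<close> is still the zero combination.\<close>

definition is_difference :: "'a \<Rightarrow> 'a \<Rightarrow> ('a \<Rightarrow>\<^sub>0 'r::ring) \<Rightarrow> bool" where
  "is_difference x y p \<longleftrightarrow>
     (x = y \<and> p = 0) \<or>
     (\<exists>e. is_unity e \<and> p = Poly_Mapping.single x e - Poly_Mapping.single y e)"

definition ideal_class :: "'a set \<Rightarrow> ('a \<Rightarrow>\<^sub>0 'r::ring) set \<Rightarrow> 'a \<Rightarrow> 'a set" where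
  "ideal_class X I x0 = {x \<in> X. \<exists>p\<in>I. is_difference x x0 p}"

lemma is_unity_iff_eq_1: "is_unity (e :: 'r::ring_1) \<longleftrightarrow> e = 1"
  unfolding is_unity_def by (metis mult_1_left mult_1_right)

lemma ideal_class_unital:
  fixes I :: "('a \<Rightarrow>\<^sub>0 'r::ring_1) set"
  shows "ideal_class X I x0 =
    {x \<in> X. Poly_Mapping.single x 1 - Poly_Mapping.single x0 1 \<in> I}"
  unfolding ideal_class_def is_difference_def is_unity_iff_eq_1 by auto

end

(* Membership of the difference in I is a congruence on X: since I absorbs products, x - y \<in> I gives
   x.z - y.z \<in> I and z.x - z.y \<in> I. Idempotence makes the class of x0 closed under the product, and
   as X is finite, the injective right translations by elements of a class permute that class. *)
theory Submission imports Defs begin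

text \<open>Outside the supports a coefficient is 0, so the extra terms vanish. Index sets that may
  be enlarged let several products be expanded over the same sets, although cancellation can shrink
  the support of a difference.\<close>

lemma qmult_superset:
  fixes p q :: "'a \<Rightarrow>\<^sub>0 'r::ring"
  assumes "finite A" "Poly_Mapping.keys p \<subseteq> A" "finite B" "Poly_Mapping.keys q \<subseteq> B"
  shows "qmult f p q = (\<Sum>x\<in>A. \<Sum>y\<in>B.
    Poly_Mapping.single (f x y) (Poly_Mapping.lookup p x * Poly_Mapping.lookup q y))"
proof -
  have "(\<Sum>y\<in>Poly_Mapping.keys q.
      Poly_Mapping.single (f x y) (Poly_Mapping.lookup p x * Poly_Mapping.lookup q y)) =
    (\<Sum>y\<in>B. Poly_Mapping.single (f x y) (Poly_Mapping.lookup p x * Poly_Mapping.lookup q y))" for x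
    by (rule sum.mono_neutral_left) (use assms in \<open>auto simp: in_keys_iff\<close>)
  then show ?thesis
    unfolding qmult_def
    by simp (rule sum.mono_neutral_left, use assms in \<open>auto simp: in_keys_iff\<close>)
qed

lemma qmult_diff_left:
  fixes p q r :: "'a \<Rightarrow>\<^sub>0 'r::ring"
  shows "qmult f (p - q) r = qmult f p r - qmult f q r"
proof -
  \<comment> \<open>One index set for all three products; listing the keys of \<open>p - q\<close>
    makes each required inclusion immediate.\<close>
  let ?A = "Poly_Mapping.keys p \<union> Poly_Mapping.keys q \<union> Poly_Mapping.keys (p - q)"
  show ?thesis
    by (subst (1 2 3) qmult_superset[where A = ?A and B = "Poly_Mapping.keys r"])
      (auto simp: lookup_minus left_diff_distrib single_diff sum_subtractf)
qed

lemma qmult_diff_right: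
  fixes p q r :: "'a \<Rightarrow>\<^sub>0 'r::ring"
  shows "qmult f r (p - q) = qmult f r p - qmult f r q"
proof -
  let ?B = "Poly_Mapping.keys p \<union> Poly_Mapping.keys q \<union> Poly_Mapping.keys (p - q)"
  show ?thesis
    by (subst (1 2 3) qmult_superset[where A = "Poly_Mapping.keys r" and B = ?B])
      (auto simp: lookup_minus right_diff_distrib single_diff sum_subtractf)
qed

lemma qmult_single:
  fixes a b :: "'r::ring"
  shows "qmult f (Poly_Mapping.single x a) (Poly_Mapping.single y b) =
    Poly_Mapping.single (f x y) (a * b)"
  \<comment> \<open>Singletons contain the supports even when \<open>a\<close> or \<open>b\<close>
    is 0 and a support is empty.\<close>
  by (subst qmult_superset[where A = "{x}" and B = "{y}"]) auto

text \<open>Both equal \<open>d * e\<close>. This identifies the unities hidden in two separate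
  memberships, so that their differences can be added.\<close>

lemma is_unity_unique: "is_unity d \<Longrightarrow> is_unity e \<Longrightarrow> d = e"
  unfolding is_unity_def by metis

text \<open>As 0 lies in \<open>I\<close>, the zero difference reduces to \<open>x = y\<close>. Over
  a ring without unity only this case remains, and the class of a point of \<open>X\<close> is a
  singleton.\<close>

lemma mem_ideal_class_iff:
  assumes "two_sided_ideal X f I"
  shows "x \<in> ideal_class X I y \<longleftrightarrow> x \<in> X \<and>
    (x = y \<or> (\<exists>e. is_unity e \<and> Poly_Mapping.single x e - Poly_Mapping.single y e \<in> I))"
  using assms unfolding ideal_class_def is_difference_def two_sided_ideal_def by auto

lemma ideal_class_sym:
  assumes I: "two_sided_ideal X f I" and "y \<in> X" "x \<in> ideal_class X I y"
  shows "y \<in> ideal_class X I x"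
proof -
  have "- (Poly_Mapping.single x e - Poly_Mapping.single y e) \<in> I"
    if "Poly_Mapping.single x e - Poly_Mapping.single y e \<in> I" for e
    using that I unfolding two_sided_ideal_def by blast
  then show ?thesis
    using assms(2,3) unfolding mem_ideal_class_iff[OF I] by auto
qed

text \<open>The two differences telescope once their unities are identified.\<close>

lemma ideal_class_trans:
  assumes I: "two_sided_ideal X f I"
    and "x \<in> ideal_class X I y" "y \<in> ideal_class X I z"
  shows "x \<in> ideal_class X I z"
proof -
  have "(Poly_Mapping.single x e - Poly_Mapping.single y e) +
      (Poly_Mapping.single y e - Poly_Mapping.single z e) \<in> I"
    if "Poly_Mapping.single x e - Poly_Mapping.single y e \<in> I"
      "Poly_Mapping.single y e - Poly_Mapping.single z e \<in> I" for e
    using that I unfolding two_sided_ideal_def by blast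
  then show ?thesis
    using assms(2,3) unfolding mem_ideal_class_iff[OF I] by (auto dest: is_unity_unique)
qed

text \<open>The factors are replaced one at a time, through \<open>f y x'\<close>: the first step
  multiplies a member of \<open>I\<close> on the right, the second on the left, so both sides of the
  ideal property are used.\<close>

lemma ideal_class_cong:
  assumes I: "two_sided_ideal X f I" and X: "quandle X f"
    and y: "y \<in> X" "y' \<in> X"
    and x: "x \<in> ideal_class X I y" and x': "x' \<in> ideal_class X I y'"
  shows "f x x' \<in> ideal_class X I (f y y')"
proof (rule ideal_class_trans[OF I])
  have closed: "f a b \<in> X" if "a \<in> X" "b \<in> X" for a b
    using X that unfolding quandle_def by blast
  have xX: "x \<in> X" "x' \<in> X"
    using x x' unfolding mem_ideal_class_iff[OF I] by auto
  have single_mem: "Poly_Mapping.single a e \<in> quandle_ring X" if "a \<in> X" for a and e :: 'b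
    using that unfolding quandle_ring_def by auto
  have "Poly_Mapping.single (f x x') e - Poly_Mapping.single (f y x') e \<in> I"
    if "is_unity e" "Poly_Mapping.single x e - Poly_Mapping.single y e \<in> I" for e
  proof -
    have "qmult f (Poly_Mapping.single x e - Poly_Mapping.single y e)
        (Poly_Mapping.single x' e) \<in> I"
      using that(2) I single_mem[OF xX(2)] unfolding two_sided_ideal_def by blast
    \<comment> \<open>After distributing, both coefficients are \<open>e * e\<close>, which is
      \<open>e\<close>.\<close>
    then show ?thesis
      using that(1) by (simp add: qmult_diff_left qmult_single is_unity_def)
  qed
  then show "f x x' \<in> ideal_class X I (f y x')"
    using x closed[OF xX] unfolding mem_ideal_class_iff[OF I] by auto
  have "Poly_Mapping.single (f y x') e - Poly_Mapping.single (f y y') e \<in> I"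
    if "is_unity e" "Poly_Mapping.single x' e - Poly_Mapping.single y' e \<in> I" for e
  proof -
    have "qmult f (Poly_Mapping.single y e)
        (Poly_Mapping.single x' e - Poly_Mapping.single y' e) \<in> I"
      using that(2) I single_mem[OF y(1)] unfolding two_sided_ideal_def by blast
    then show ?thesis
      using that(1) by (simp add: qmult_diff_right qmult_single is_unity_def)
  qed
  then show "f y x' \<in> ideal_class X I (f y y')"
    using x' closed[OF y(1) xX(2)] unfolding mem_ideal_class_iff[OF I] by auto
qed

lemma ideal_class_subquandle:
  assumes I: "two_sided_ideal X f I" and X: "quandle X f" "finite X" and x0: "x0 \<in> X"
  shows "subquandle (ideal_class X I x0) X f"
proof -
  let ?C = "ideal_class X I x0"
  have sub: "?C \<subseteq> X"
    unfolding ideal_class_def by auto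
  have ne: "x0 \<in> ?C"
    using x0 unfolding mem_ideal_class_iff[OF I] by simp
  have "f x0 x0 = x0"
    using X(1) x0 unfolding quandle_def by blast
  then have closed: "f x y \<in> ?C" if "x \<in> ?C" "y \<in> ?C" for x y
    using ideal_class_cong[OF I X(1) x0 x0 that] by simp
  have inj: "z = z'" if "f z y = f z' y" "z \<in> ?C" "z' \<in> ?C" "y \<in> ?C" for y z z'
  proof -
    have "f z y \<in> X" "y \<in> X" "z \<in> X" "z' \<in> X"
      using closed that sub by auto
    then show ?thesis
      using X(1) that(1) unfolding quandle_def by metis
  qed
  have solve: "\<exists>!z. z \<in> ?C \<and> x = f z y" if "x \<in> ?C" "y \<in> ?C" for x y
  proof -
    \<comment> \<open>Axiom (R1) in \<open>X\<close> gives a solution in \<open>X\<close>, with no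
      information on its class. Inside \<open>?C\<close> it comes from finiteness: an injective
      self-map of a finite set is onto.\<close>
    have "(\<lambda>z. f z y) ` ?C = ?C"
      by (rule endo_inj_surj)
        (use that inj closed sub X(2) in \<open>auto simp: inj_on_def intro: finite_subset\<close>)
    then obtain z where "z \<in> ?C" "x = f z y"
      using \<open>x \<in> ?C\<close> by blast
    then show ?thesis
      using inj[OF _ _ _ \<open>y \<in> ?C\<close>] by (intro ex1I[of _ z]) auto
  qed
  have dist: "f (f x y) z = f (f x z) (f y z)" if "x \<in> X" "y \<in> X" "z \<in> X" for x y z
    using X(1) that unfolding quandle_def by blast
  have idem: "f x x = x" if "x \<in> X" for x
    using X(1) that unfolding quandle_def by blast
  have "quandle ?C f"
    unfolding quandle_def
  proof (intro conjI ballI)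
    show "?C \<noteq> {}"
      using ne by blast
  \<comment> \<open>The remaining axioms, (R2) and (Q1), are identities and pass to subsets.\<close>
  qed (fact closed solve | erule subsetD[OF sub] | rule dist idem)+
  then show ?thesis
    unfolding subquandle_def using sub by simp
qed

text \<open>Membership is an equivalence relation on \<open>X\<close>; \<open>T\<close> consists of
  one chosen representative of each class.\<close>

lemma ideal_class_transversal:
  assumes I: "two_sided_ideal X f I"
  obtains T where "T \<subseteq> X" "X = (\<Union>x\<in>T. ideal_class X I x)"
    "disjoint_family_on (ideal_class X I) T"
proof
  \<comment> \<open>The choice depends on the class as a set, so equivalent points receive the same
    representative.\<close>
  define g where "g C = (SOME y. y \<in> C)" for C :: "'a set"
  let ?T = "(\<lambda>x. g (ideal_class X I x)) ` X"
  have g: "g (ideal_class X I x) \<in> ideal_class X I x" if "x \<in> X" for x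
    unfolding g_def by (rule someI[of _ x]) (use that in \<open>simp add: mem_ideal_class_iff[OF I]\<close>)
  have eq: "ideal_class X I x = ideal_class X I y" if "y \<in> X" "x \<in> ideal_class X I y" for x y
    using that ideal_class_sym[OF I that] ideal_class_trans[OF I] by blast
  have sub: "ideal_class X I x \<subseteq> X" for x
    unfolding ideal_class_def by auto
  show T: "?T \<subseteq> X"
    using g sub by blast
  show "X = (\<Union>x\<in>?T. ideal_class X I x)"
    using g sub ideal_class_sym[OF I] by blast
  show "disjoint_family_on (ideal_class X I) ?T"
    unfolding disjoint_family_on_def
  proof (intro ballI impI)
    fix s t assume st: "s \<in> ?T" "t \<in> ?T" and "s \<noteq> t"
    \<comment> \<open>The family is indexed by points, so distinct points of \<open>?T\<close> must
      have distinct classes: each is recovered from its class by \<open>g\<close>.\<close>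
    have rep: "r = g (ideal_class X I r)" if "r \<in> ?T" for r
      using that by (auto simp: eq[OF _ g])
    show "ideal_class X I s \<inter> ideal_class X I t = {}"
    proof (rule ccontr)
      assume "\<not> ?thesis"
      \<comment> \<open>Both classes equal the class of any common element.\<close>
      then have "ideal_class X I s = ideal_class X I t"
        using eq st T by blast
      then show False
        using rep[OF st(1)] rep[OF st(2)] \<open>s \<noteq> t\<close> by simp
    qed
  qed
qed

theorem theorem4p1:
  fixes X :: "'a set" and f :: "'a \<Rightarrow> 'a \<Rightarrow> 'a"
    and I :: "('a \<Rightarrow>\<^sub>0 'r::ring) set"
  assumes "quandle X f" and "finite X" and "two_sided_ideal X f I"
  shows "(\<forall>x0\<in>X. subquandle (ideal_class X I x0) X f) \<and>
    (\<exists>T. T \<subseteq> X \<and> finite T \<and> X = (\<Union>x\<in>T. ideal_class X I x) \<and>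
         disjoint_family_on (ideal_class X I) T)"
proof (intro conjI ballI)
  show "subquandle (ideal_class X I x0) X f" if "x0 \<in> X" for x0
    using assms(3,1,2) that by (rule ideal_class_subquandle)
  obtain T where "T \<subseteq> X" "X = (\<Union>x\<in>T. ideal_class X I x)" "disjoint_family_on (ideal_class X I) T"
    using ideal_class_transversal[OF assms(3)] .
  then show "\<exists>T. T \<subseteq> X \<and> finite T \<and> X = (\<Union>x\<in>T. ideal_class X I x) \<and>
      disjoint_family_on (ideal_class X I) T"
    using finite_subset[OF _ assms(2)] by (intro exI[of _ T] conjI)
qed

end
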